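(* Let $\vartheta_{\mathbf P}=(\vartheta,\mathbf P)$ be a compatible, irreducible Pisot random substitution on $\mathcal A=\{1,\dots,d\}$. The vector of Rauzy measures $\overline\mu=(\overline\mu_a)_{a\in\mathcal A}$ satisfies, for every $a\in\mathcal A$, $$\overline\mu_a=\frac1\lambda\sum_{(p,b,s)}\mathbb P[\vartheta_{\mathbf P}(b)=pas]\ \overline\mu_b\circ f_p^{-1},$$ where the sum runs over all $(p,b,s)\in\mathcal A^*\times\mathcal A\times\mathcal A^*$ with $pas\in\vartheta(b)$, and $f_p\colon\mathbb H\to\mathbb H$, $f_p(x)=h(x)+\pi(\psi(p))$.
   Context: Let $\mathcal A^+$ be the set of non-empty finite words over $\mathcal A$, $\mathcal A^*=\mathcal A^+\cup\{\varepsilon\}$ with $\varepsilon$ the empty word, $|u|$ the length of $u$, $|u|_i$ the number of occurrences of $i$ in $u$, $\psi(u)=(|u|_1,\dots,|u|_d)^T$, and $u_{[1,m]}=u_1\cdots u_m$ (empty if $m=0$). A random substitution $\vartheta_{\mathbf P}=(\vartheta,\mathbf P)$ is a map $\vartheta$ assigning to each letter $i$ a non-empty finite set $\vartheta(i)\subset\mathcal A^+$ together with probability vectors $p_i\colon\vartheta(i)\to(0,1]$, $\sum_{v\in\vartheta(i)}p_i(v)=1$; $\mathbb P[\vartheta_{\mathbf P}(i)=v]=p_i(v)$. For a word $u=u_1\cdots u_n$, $\vartheta_{\mathbf P}(u)$ is the random word obtained by independently replacing each letter $u_k$ by $v\in\vartheta(u_k)$ with probability $p_{u_k}(v)$ and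 concatenating in order; $(\vartheta_{\mathbf P}^n(u))_{n\ge0}$ is the Markov chain on $\mathcal A^+$ started at $u$ with these transition probabilities, and $\mathbb E$ is the corresponding expectation. It is compatible if $\psi(u)=\psi(v)$ for all $a\in\mathcal A$, $u,v\in\vartheta(a)$; then all realisations of $\vartheta_{\mathbf P}^n(v)$ have a common length $|\vartheta^n(v)|$, and the substitution matrix is $M_{i,j}=|v|_i$ for any $v\in\vartheta(j)$. It is primitive if $M$ is primitive with Perron–Frobenius eigenvalue $\lambda>1$. A compatible primitive random substitution is irreducible Pisot if $\lambda$ is a Pisot number and the characteristic polynomial of $M$ is irreducible over $\mathbb Z$. $\mathbf L,\mathbf R$ are left and right Perron–Frobenius eigenvectors of $M$ with $\|\mathbf R\|_1=1=\mathbf L^T\mathbf R$; $\mathbb H\subset\mathbb R^d$ is the hyperplane orthogonal to $\mathbf L$; $\pi$ is the linear projection along $\mathbf R$ onto $\mathbb H$; $h$ is the restriction of $M$ to $\mathbb H$. For a finite word $w$ and $a\in\mathcal A$, $\mu_a(w)=\sum_{0\le m\le|w|-1,\ w_{m+1}=a}\delta_{\pi(\psi(w_{[1,m]}))}$. The Rauzy measure $\overline\mu_a$ is the weak limit $\overline\mu_a=\lim_{n\to\infty}|\vartheta^n(v)|^{-1}\,\mathbb E[\mu_a(\vartheta_{\mathbf P}^n(v))]$, which exists and is the same for every $v\in\mathcal A^+$. *)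

theory Defs
  imports "HOL-Probability.Probability" "HOL-Computational_Algebra.Computational_Algebra"
begin

text \<open>
  The alphabet is the finite type \<open>'d\<close>, so \<open>d = CARD('d)\<close> and letters index the coordinates of
  \<open>real ^ 'd\<close>. Words are lists; with 0-based list indexing, \<open>w ! m\<close> is the letter following the
  prefix \<open>take m w\<close> of length \<open>m\<close>.
\<close>

definition abel :: "'d::finite list \<Rightarrow> real ^ 'd"
  where "abel w = (\<chi> i. real (count_list w i))"


section \<open>Matrices\<close>

definition char_poly :: "'a::comm_ring_1 ^ 'n ^ 'n \<Rightarrow> 'a poly"
  where "char_poly A = det (\<chi> i j. (if i = j then [:0, 1:] else 0) - [:A $ i $ j:])"

definition primitive_matrix :: "real ^ 'n ^ 'n \<Rightarrow> bool"
  where "primitive_matrix A \<longleftrightarrow>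
    (\<forall>i j. 0 \<le> A $ i $ j) \<and> (\<exists>k\<ge>1. \<forall>i j. 0 < (((**) A ^^ k) (mat 1)) $ i $ j)"

text \<open>
  The Perron--Frobenius eigenvalue of a primitive matrix: the positive eigenvalue that strictly
  dominates the modulus of every other complex eigenvalue.
\<close>
definition is_pf_eigenvalue :: "real ^ 'n ^ 'n \<Rightarrow> real \<Rightarrow> bool"
  where "is_pf_eigenvalue A l \<longleftrightarrow>
    0 < l \<and> poly (char_poly A) l = 0 \<and>
    (\<forall>z::complex. poly (map_poly of_real (char_poly A)) z = 0 \<and> z \<noteq> of_real l \<longrightarrow> cmod z < l)"

definition is_right_pf_eigenvector :: "real ^ 'n ^ 'n \<Rightarrow> real \<Rightarrow> real ^ 'n \<Rightarrow> bool"
  where "is_right_pf_eigenvector A l R \<longleftrightarrow> A *v R = l *\<^sub>R R \<and> (\<forall>i. 0 < R $ i)"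

definition is_left_pf_eigenvector :: "real ^ 'n ^ 'n \<Rightarrow> real \<Rightarrow> real ^ 'n \<Rightarrow> bool"
  where "is_left_pf_eigenvector A l L \<longleftrightarrow> L v* A = l *\<^sub>R L \<and> (\<forall>i. 0 < L $ i)"

text \<open>
  The polynomial \<open>p\<close> below is the minimal polynomial of \<open>x\<close>, so its other complex roots are the
  other Galois conjugates of \<open>x\<close>.
\<close>
definition pisot_number :: "real \<Rightarrow> bool"
  where "pisot_number x \<longleftrightarrow>
    1 < x \<and>
    (\<exists>p :: int poly. lead_coeff p = 1 \<and> irreducible p \<and> poly (map_poly of_int p) x = 0 \<and>
      (\<forall>z::complex. poly (map_poly of_int p) z = 0 \<and> z \<noteq> of_real x \<longrightarrow> cmod z < 1))"


section \<open>Random substitutions\<close>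

text \<open>
  A random substitution is given by one probability mass function on words for each letter:
  \<open>set_pmf (\<theta> i)\<close> is the set of possible images of \<open>i\<close> and \<open>pmf (\<theta> i)\<close>, which is positive
  exactly on that set, is its probability vector.
\<close>
definition random_substitution :: "('d \<Rightarrow> 'd list pmf) \<Rightarrow> bool"
  where "random_substitution \<theta> \<longleftrightarrow> (\<forall>i. finite (set_pmf (\<theta> i)) \<and> [] \<notin> set_pmf (\<theta> i))"

text \<open>The law of the random image of a word; different positions are replaced independently.\<close>
fun subst_word :: "('d \<Rightarrow> 'd list pmf) \<Rightarrow> 'd list \<Rightarrow> 'd list pmf"
  where
    "subst_word \<theta> [] = return_pmf []"
  | "subst_word \<theta> (x # xs) =
      bind_pmf (\<theta> x) (\<lambda>u. bind_pmf (subst_word \<theta> xs) (\<lambda>w. return_pmf (u @ w)))"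

text \<open>The law at time \<open>n\<close> of the Markov chain started at the given word.\<close>
primrec subst_iter :: "('d \<Rightarrow> 'd list pmf) \<Rightarrow> nat \<Rightarrow> 'd list \<Rightarrow> 'd list pmf"
  where
    "subst_iter \<theta> 0 v = return_pmf v"
  | "subst_iter \<theta> (Suc n) v = bind_pmf (subst_iter \<theta> n v) (subst_word \<theta>)"

definition compatible :: "('d::finite \<Rightarrow> 'd list pmf) \<Rightarrow> bool"
  where "compatible \<theta> \<longleftrightarrow> (\<forall>a. \<forall>u\<in>set_pmf (\<theta> a). \<forall>v\<in>set_pmf (\<theta> a). abel u = abel v)"

text \<open>
  For compatible substitutions the next two notions do not depend on the chosen realisation.
  The matrix is polymorphic in the entries because irreducibility of its characteristic
  polynomial concerns \<open>int poly\<close>.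
\<close>
definition iter_length :: "('d \<Rightarrow> 'd list pmf) \<Rightarrow> nat \<Rightarrow> 'd list \<Rightarrow> nat"
  where "iter_length \<theta> n v = length (SOME w. w \<in> set_pmf (subst_iter \<theta> n v))"

definition subst_matrix :: "('d::finite \<Rightarrow> 'd list pmf) \<Rightarrow> 'a::semiring_1 ^ 'd ^ 'd"
  where "subst_matrix \<theta> = (\<chi> i j. of_nat (count_list (SOME v. v \<in> set_pmf (\<theta> j)) i))"

definition primitive_substitution :: "('d::finite \<Rightarrow> 'd list pmf) \<Rightarrow> real \<Rightarrow> bool"
  where "primitive_substitution \<theta> l \<longleftrightarrow>
    primitive_matrix (subst_matrix \<theta>) \<and> is_pf_eigenvalue (subst_matrix \<theta>) l \<and> 1 < l"

text \<open>Here \<open>l\<close> is the Perron--Frobenius eigenvalue of the substitution matrix.\<close>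
definition irreducible_pisot :: "('d::finite \<Rightarrow> 'd list pmf) \<Rightarrow> real \<Rightarrow> bool"
  where "irreducible_pisot \<theta> l \<longleftrightarrow>
    compatible \<theta> \<and> primitive_substitution \<theta> l \<and> pisot_number l \<and>
    irreducible (char_poly (subst_matrix \<theta> :: int ^ 'd ^ 'd))"


section \<open>The contracting hyperplane\<close>

definition hyperplane :: "real ^ 'd::finite \<Rightarrow> (real ^ 'd) set"
  where "hyperplane L = {x. L \<bullet> x = 0}"

abbreviation borel_hyperplane :: "real ^ 'd::finite \<Rightarrow> (real ^ 'd) measure"
  where "borel_hyperplane L \<equiv> restrict_space borel (hyperplane L)"

text \<open>The projection along \<open>R\<close> onto the hyperplane, provided that \<open>L \<bullet> R = 1\<close>.\<close>
definition proj :: "real ^ 'd::finite \<Rightarrow> real ^ 'd \<Rightarrow> real ^ 'd \<Rightarrow> real ^ 'd"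
  where "proj L R x = x - (L \<bullet> x) *\<^sub>R R"

text \<open>Only its restriction to the hyperplane, which it maps to itself, is relevant.\<close>
definition prefix_map ::
    "('d::finite \<Rightarrow> 'd list pmf) \<Rightarrow> real ^ 'd \<Rightarrow> real ^ 'd \<Rightarrow> 'd list \<Rightarrow> real ^ 'd \<Rightarrow> real ^ 'd"
  where "prefix_map \<theta> L R p x = subst_matrix \<theta> *v x + proj L R (abel p)"


section \<open>Rauzy measures\<close>

text \<open>
  The sum of Dirac measures over all occurrences of \<open>a\<close> in \<open>w\<close>, with multiplicities, as the
  image of a counting measure.
\<close>
definition word_measure ::
    "real ^ 'd::finite \<Rightarrow> real ^ 'd \<Rightarrow> 'd \<Rightarrow> 'd list \<Rightarrow> (real ^ 'd) measure"
  where "word_measure L R a w =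
    distr (count_space {m. m < length w \<and> w ! m = a}) (borel_hyperplane L)
      (\<lambda>m. proj L R (abel (take m w)))"

text \<open>The expectation of a random measure is taken set by set.\<close>
definition expected_measure ::
    "('d::finite \<Rightarrow> 'd list pmf) \<Rightarrow> real ^ 'd \<Rightarrow> real ^ 'd \<Rightarrow> 'd \<Rightarrow> nat \<Rightarrow> 'd list \<Rightarrow> (real ^ 'd) measure"
  where "expected_measure \<theta> L R a n v =
    measure_of (hyperplane L) (sets (borel_hyperplane L))
      (\<lambda>B. \<integral>\<^sup>+ w. emeasure (word_measure L R a w) B \<partial>measure_pmf (subst_iter \<theta> n v))"

definition weak_limit_on ::
    "'a::topological_space set \<Rightarrow> (nat \<Rightarrow> 'a measure) \<Rightarrow> 'a measure \<Rightarrow> bool"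
  where "weak_limit_on H \<nu> \<mu> \<longleftrightarrow>
    (\<forall>f :: 'a \<Rightarrow> real. continuous_on H f \<and> bounded (f ` H) \<longrightarrow>
      (\<lambda>n. \<integral>x. f x \<partial>\<nu> n) \<longlonglongrightarrow> (\<integral>x. f x \<partial>\<mu>))"

text \<open>
  \<open>\<mu>\<close> is the Rauzy measure of the letter \<open>a\<close>: a finite Borel measure on the hyperplane that is
  the common weak limit for all non-empty starting words.
\<close>
definition is_rauzy_measure ::
    "('d::finite \<Rightarrow> 'd list pmf) \<Rightarrow> real ^ 'd \<Rightarrow> real ^ 'd \<Rightarrow> 'd \<Rightarrow> (real ^ 'd) measure \<Rightarrow> bool"
  where "is_rauzy_measure \<theta> L R a \<mu> \<longleftrightarrow>
    sets \<mu> = sets (borel_hyperplane L) \<and> finite_measure \<mu> \<and>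
    (\<forall>v. v \<noteq> [] \<longrightarrow>
      weak_limit_on (hyperplane L)
        (\<lambda>n. scale_measure (ennreal (1 / real (iter_length \<theta> n v))) (expected_measure \<theta> L R a n v))
        \<mu>)"

end

theory Submission
  imports Defs
begin

text \<open>
  Write \<open>M\<close> for the substitution matrix, \<open>\<pi>\<close> for the projection and \<open>f\<^sub>p\<close> for the prefix map, so
  \<open>f\<^sub>p (\<pi> x) = \<pi> (M x + \<psi> p)\<close>. The identity is the limit of an exact identity at finite time. An
  occurrence of \<open>a\<close> in a realisation of \<open>\<theta>(w)\<close> lies in the image \<open>p a s\<close> of exactly one letter \<open>b\<close>
  of \<open>w\<close>; if \<open>q\<close> is the prefix of \<open>w\<close> before that letter, then compatibility makes the
  abelianisation of the prefix before the occurrence equal to \<open>M \<psi>(q) + \<psi>(p)\<close>, whatever the random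
  images of the letters of \<open>q\<close> are. Hence the point mass at \<open>\<pi> \<psi>(q)\<close> is moved to
  \<open>f\<^sub>p (\<pi> \<psi>(q))\<close> with weight \<open>pmf (\<theta> b) (p a s)\<close>. Consequently, for every test
  function \<open>f\<close>, the expected integral of \<open>f\<close> against the word measure of \<open>a\<close> at time \<open>n + 1\<close> is the
  sum over \<open>(p, b, s)\<close> of \<open>pmf (\<theta> b) (p a s)\<close> times the expected integral of \<open>f \<circ> f\<^sub>p\<close> against the
  word measure of \<open>b\<close> at time \<open>n\<close> (\<open>expectation_occ_sum_subst_iter_Suc\<close>).

  After division by the length at time \<open>n\<close>, the right-hand side converges by the definition of the
  Rauzy measures, and the left-hand side converges to the integral of \<open>f\<close> times the limit of the
  ratios of successive lengths. That this limit is the eigenvalue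
  (\<open>iter_length_ratio_tendsto\<close>) also follows from the existence of the Rauzy measures: their total
  masses are the limits of the letter frequencies, and the frequencies converge to a probability
  vector, against which \<open>L\<close> is positive; but \<open>L\<close> times the abelianisation grows exactly by the
  eigenvalue in each step, and it is asymptotically proportional to the length.

  The resulting identity for the integrals of bounded continuous functions
  (\<open>integral_rauzy_measure_eq_sum\<close>) is an identity of measures, since such integrals
  determine a finite Borel measure on a metric space
  (\<open>measure_eq_sum_if_integral_continuous_eq_sum\<close>).
\<close>

section \<open>Sums over the occurrences of a letter\<close>

text \<open>
  With \<open>F p = f (proj L R (abel p))\<close> this is the integral of \<open>f\<close> against \<open>word_measure L R a w\<close>.
  Taking functions of prefixes instead of points makes concatenation of words a shift of the
  argument, which is what inductions over words need.
\<close>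
definition occ_sum :: "('a list \<Rightarrow> real) \<Rightarrow> 'a \<Rightarrow> 'a list \<Rightarrow> real"
  where "occ_sum F a w = (\<Sum>m<length w. if w ! m = a then F (take m w) else 0)"

lemma occ_sum_append:
  "occ_sum F a (u @ w) = occ_sum F a u + occ_sum (\<lambda>p. F (u @ p)) a w"
proof (induction u arbitrary: F)
  case Nil
  then show ?case by (simp add: occ_sum_def)
next
  case (Cons x u)
  have *: "occ_sum F a (x # v) = (if x = a then F [] else 0) + occ_sum (\<lambda>p. F (x # p)) a v"
    for F :: "_ list \<Rightarrow> real" and v
    by (simp add: occ_sum_def sum.lessThan_Suc_shift del: sum.lessThan_Suc cong: if_cong)
  show ?case using Cons[of "\<lambda>p. F (x # p)"] by (simp add: *)
qed

lemma occ_sum_one: "occ_sum (\<lambda>_. 1) a w = real (count_list w a)"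
proof (induction w)
  case (Cons x w)
  then show ?case using occ_sum_append[of "\<lambda>_. 1" a "[x]" w] by (simp add: occ_sum_def)
qed (simp add: occ_sum_def)

lemma occ_sum_eq_sum_positions:
  "occ_sum F a w = (\<Sum>m\<in>{m. m < length w \<and> w ! m = a}. F (take m w))"
proof -
  have "{m. m < length w \<and> w ! m = a} = {m\<in>{..<length w}. w ! m = a}" by auto
  then show ?thesis by (simp only: occ_sum_def sum.inter_filter finite_lessThan)
qed

lemma occ_sum_eq_sum_decompositions:
  "occ_sum F a w = (\<Sum>(p, s)\<in>{(p, s). p @ [a] @ s = w}. F p)"
  unfolding occ_sum_eq_sum_positions
  by (rule sum.reindex_bij_witness[where i = "\<lambda>(p, s). length p"
        and j = "\<lambda>m. (take m w, drop (Suc m) w)"])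
     (auto simp: id_take_nth_drop[symmetric] nth_append)

text \<open>
  Sorting the positions of a word by the letter found there.
\<close>
lemma sum_positions_eq_sum_occ_sum:
  fixes h :: "'a::finite \<Rightarrow> 'a list \<Rightarrow> real"
  shows "(\<Sum>m<length w. h (w ! m) (take m w)) = (\<Sum>b\<in>UNIV. occ_sum (h b) b w)"
  unfolding occ_sum_def by (subst sum.swap) simp

lemma finite_decompositions:
  "finite S \<Longrightarrow> finite {(p, s). p @ [a] @ s \<in> S}"
proof -
  assume S: "finite S"
  have "(p, s) \<in> (\<Union>w\<in>S. (\<lambda>m. (take m w, drop (Suc m) w)) ` {..<length w})"
    if "p @ [a] @ s \<in> S" for p s
    using that by (intro UN_I[of "p @ [a] @ s"] image_eqI[of _ _ "length p"]) auto
  then have "{(p, s). p @ [a] @ s \<in> S} \<subseteq> (\<Union>w\<in>S. (\<lambda>m. (take m w, drop (Suc m) w)) ` {..<length w})"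
    by auto
  then show ?thesis by (rule finite_subset) (use S in auto)
qed

section \<open>Expectations over finitely supported laws\<close>

lemma expectation_bind_pmf_finite:
  fixes h :: "'b \<Rightarrow> real"
  assumes "finite (set_pmf p)" "\<And>x. x \<in> set_pmf p \<Longrightarrow> finite (set_pmf (f x))"
  shows "measure_pmf.expectation (bind_pmf p f) h =
    measure_pmf.expectation p (\<lambda>x. measure_pmf.expectation (f x) h)"
  using assms by (subst pmf_expectation_bind[of "set_pmf p"])
    (auto simp: integral_measure_pmf[of "set_pmf p"])

text \<open>
  A decomposition \<open>p @ [a] @ s\<close> records both the word and the occurrence of \<open>a\<close> in it, so the
  expectation collapses to a sum over pairs \<open>(p, s)\<close>.
\<close>
lemma expectation_occ_sum_eq_sum_decompositions:
  assumes "finite (set_pmf P)"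
  shows "measure_pmf.expectation P (occ_sum F a) =
    (\<Sum>(p, s)\<in>{(p, s). p @ [a] @ s \<in> set_pmf P}. pmf P (p @ [a] @ s) * F p)"
proof -
  have fin: "finite {(p, s). p @ [a] @ s = u}" for u
    using finite_decompositions[of "{u}" a] by simp
  have "measure_pmf.expectation P (occ_sum F a) =
      (\<Sum>u\<in>set_pmf P. \<Sum>(p, s)\<in>{(p, s). p @ [a] @ s = u}. pmf P u * F p)"
    using assms by (subst integral_measure_pmf[of "set_pmf P"])
      (auto simp: occ_sum_eq_sum_decompositions sum_distrib_left case_prod_unfold)
  also have "\<dots> = (\<Sum>(u, p, s)\<in>(SIGMA u:set_pmf P. {(p, s). p @ [a] @ s = u}). pmf P u * F p)"
    using assms fin by (subst sum.Sigma) (auto simp: case_prod_unfold)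
  also have "\<dots> = (\<Sum>(p, s)\<in>{(p, s). p @ [a] @ s \<in> set_pmf P}. pmf P (p @ [a] @ s) * F p)"
    by (rule sum.reindex_bij_witness[where i = "\<lambda>(p, s). (p @ [a] @ s, p, s)" and j = snd]) auto
  finally show ?thesis .
qed

lemma sum_triples_eq_sum_letters:
  fixes h :: "'a list \<Rightarrow> 'd::finite \<Rightarrow> 'a list \<Rightarrow> real"
  assumes "\<And>b. finite (A b)"
  shows "(\<Sum>(p, b, s)\<in>{(p, b, s). (p, s) \<in> A b}. h p b s) = (\<Sum>b\<in>UNIV. \<Sum>(p, s)\<in>A b. h p b s)"
proof -
  have "(\<Sum>b\<in>UNIV. \<Sum>(p, s)\<in>A b. h p b s) = (\<Sum>(b, p, s)\<in>Sigma UNIV A. h p b s)"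
    using assms by (subst sum.Sigma) (auto simp: case_prod_unfold)
  also have "\<dots> = (\<Sum>(p, b, s)\<in>{(p, b, s). (p, s) \<in> A b}. h p b s)"
    by (rule sum.reindex_bij_witness[where i = "\<lambda>(p, b, s). (b, p, s)" and j = "\<lambda>(b, p, s). (p, b, s)"]) auto
  finally show ?thesis ..
qed

section \<open>Abelianisation and projection\<close>

lemma abel_Nil [simp]: "abel [] = 0"
  by (simp add: abel_def vec_eq_iff)

lemma abel_append: "abel (u @ w) = abel u + abel w"
  by (simp add: abel_def vec_eq_iff)

lemma abel_Cons: "abel (x # w) = abel [x] + abel w"
  using abel_append[of "[x]" w] by simp

lemma sum_abel: "(\<Sum>i\<in>UNIV. abel w $ i) = real (length w)"
proof (induction w)
  case (Cons x w)
  have "(\<Sum>i\<in>UNIV. abel (x # w) $ i) = (\<Sum>i\<in>UNIV. (if x = i then 1 else 0) + abel w $ i)"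
    by (intro sum.cong) (auto simp: abel_def)
  with Cons show ?case by (simp add: sum.distrib)
qed simp

text \<open>
  The \<open>x\<close>-th column of the substitution matrix is computed from one chosen realisation of the image
  of \<open>x\<close>; compatibility makes the choice immaterial.
\<close>
lemma abel_image_letter:
  assumes "compatible \<theta>" "u \<in> set_pmf (\<theta> x)"
  shows "abel u = subst_matrix \<theta> *v abel [x]"
proof -
  have "(SOME v. v \<in> set_pmf (\<theta> x)) \<in> set_pmf (\<theta> x)"
    using assms(2) by (rule someI)
  with assms have "abel u = abel (SOME v. v \<in> set_pmf (\<theta> x))"
    unfolding compatible_def by blast
  also have "\<dots> = column x (subst_matrix \<theta>)"
    by (simp add: abel_def column_def subst_matrix_def)
  also have "\<dots> = subst_matrix \<theta> *v abel [x]"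
  proof -
    have "abel [x] = axis x 1" by (auto simp: abel_def axis_def vec_eq_iff)
    then show ?thesis by (simp add: matrix_vector_mult_basis)
  qed
  finally show ?thesis .
qed

lemma abel_subst_word:
  assumes "compatible \<theta>" "u \<in> set_pmf (subst_word \<theta> w)"
  shows "abel u = subst_matrix \<theta> *v abel w"
  using assms(2)
proof (induction w arbitrary: u)
  case (Cons x w)
  from Cons.prems obtain y z where y: "y \<in> set_pmf (\<theta> x)" and z: "z \<in> set_pmf (subst_word \<theta> w)"
    and u: "u = y @ z" by auto
  show ?case
    unfolding u abel_append abel_Cons[of x w] abel_image_letter[OF assms(1) y] Cons.IH[OF z]
      matrix_vector_right_distrib ..
qed simp

lemma abel_subst_iter:
  assumes "compatible \<theta>" "w \<in> set_pmf (subst_iter \<theta> n v)"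
  shows "abel w = ((\<lambda>x. subst_matrix \<theta> *v x) ^^ n) (abel v)"
  using assms(2)
proof (induction n arbitrary: w)
  case (Suc n)
  from Suc.prems obtain y where y: "y \<in> set_pmf (subst_iter \<theta> n v)"
    and w: "w \<in> set_pmf (subst_word \<theta> y)" by auto
  show ?case
    unfolding abel_subst_word[OF assms(1) w] Suc.IH[OF y] by simp
qed simp

lemma inner_left_eigenvector:
  fixes M :: "real ^ 'd ^ 'd"
  assumes "L v* M = l *\<^sub>R L"
  shows "L \<bullet> (M *v x) = l * (L \<bullet> x)"
  by (simp only: dot_lmul_matrix[symmetric] assms inner_scaleR_left)

text \<open>
  The matrix commutes with the projection, because the coefficient \<open>L \<bullet> x\<close> and the vector \<open>R\<close> are
  multiplied by the same eigenvalue. This is how the prefix maps arise from prefixes of substituted words.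
\<close>
lemma proj_matrix_vector:
  assumes "L v* M = l *\<^sub>R L" "M *v R = l *\<^sub>R R"
  shows "proj L R (M *v x + y) = M *v proj L R x + proj L R y"
  using assms(2) by (simp add: proj_def inner_left_eigenvector[OF assms(1)] inner_add_right
     algebra_simps matrix_vector_mult_scaleR matrix_vector_mult_diff_distrib)

lemma proj_in_hyperplane: "L \<bullet> R = 1 \<Longrightarrow> proj L R x \<in> hyperplane L"
  by (simp add: proj_def hyperplane_def inner_diff_right)

section \<open>One substitution step\<close>

lemma finite_set_pmf_subst_word:
  "random_substitution \<theta> \<Longrightarrow> finite (set_pmf (subst_word \<theta> w))"
  by (induction w) (auto simp: random_substitution_def)

lemma finite_set_pmf_subst_iter:
  "random_substitution \<theta> \<Longrightarrow> finite (set_pmf (subst_iter \<theta> n v))"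
  by (induction n) (auto simp: finite_set_pmf_subst_word)

text \<open>
  The images of the letters before position \<open>m\<close> enter the prefixes of the image word only through
  their abelianisation, which is deterministic. So only the randomness of the image of the letter
  at position \<open>m\<close> is left in its contribution. The induction over \<open>w\<close> absorbs the image of the first
  letter into a translate of \<open>g\<close>.
\<close>
lemma expectation_occ_sum_subst_word:
  assumes "random_substitution \<theta>" "compatible \<theta>"
  shows "measure_pmf.expectation (subst_word \<theta> w) (occ_sum (\<lambda>p. g (abel p)) a) =
    (\<Sum>m<length w. measure_pmf.expectation (\<theta> (w ! m))
      (occ_sum (\<lambda>p. g (subst_matrix \<theta> *v abel (take m w) + abel p)) a))"
proof (induction w arbitrary: g)
  case Nil
  then show ?case by (simp add: occ_sum_def)
next
  case (Cons x w)
  let ?M = "subst_matrix \<theta> :: real ^ 'a ^ 'a"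
  let ?E = "measure_pmf.expectation"
  have fin: "finite (set_pmf (\<theta> b))" "finite (set_pmf (subst_word \<theta> w))" for b
    using assms(1) finite_set_pmf_subst_word by (auto simp: random_substitution_def)
  have int: "integrable (measure_pmf (\<theta> b)) f" "integrable (measure_pmf (subst_word \<theta> w)) f'"
    for b and f f' :: "_ \<Rightarrow> real"
    using fin by (auto intro: integrable_measure_pmf_finite)
  let ?c = "?E (subst_word \<theta> w) (occ_sum (\<lambda>p. g (?M *v abel [x] + abel p)) a)"
  have "?E (subst_word \<theta> (x # w)) (occ_sum (\<lambda>p. g (abel p)) a) =
      ?E (\<theta> x) (\<lambda>u. ?E (subst_word \<theta> w) (\<lambda>y. occ_sum (\<lambda>p. g (abel p)) a (u @ y)))"
    using fin by (simp add: expectation_bind_pmf_finite)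
  also have "\<dots> = ?E (\<theta> x) (\<lambda>u. occ_sum (\<lambda>p. g (abel p)) a u + ?c)"
    by (intro integral_cong_AE)
       (simp_all add: AE_measure_pmf_iff occ_sum_append abel_append int
          abel_image_letter[OF assms(2), of _ x])
  also have "\<dots> = ?E (\<theta> x) (occ_sum (\<lambda>p. g (abel p)) a) + ?c"
    by (simp add: int)
  also have "?c = (\<Sum>m<length w. ?E (\<theta> (w ! m))
      (occ_sum (\<lambda>p. g (?M *v abel (take (Suc m) (x # w)) + abel p)) a))"
    using Cons[of "\<lambda>y. g (?M *v abel [x] + y)"]
    by (simp add: abel_Cons[of x "take _ w"] matrix_vector_right_distrib add.assoc)
  finally show ?case
    by (simp add: sum.lessThan_Suc_shift del: sum.lessThan_Suc)
qed

lemma expectation_occ_sum_subst_word_eq_sum_triples: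
  fixes \<theta> :: "'d::finite \<Rightarrow> 'd list pmf"
  assumes "random_substitution \<theta>" "compatible \<theta>"
  shows "measure_pmf.expectation (subst_word \<theta> w) (occ_sum (\<lambda>p. g (abel p)) a) =
    (\<Sum>(p, b, s)\<in>{(p, b, s). p @ [a] @ s \<in> set_pmf (\<theta> b)}. pmf (\<theta> b) (p @ [a] @ s) *
      occ_sum (\<lambda>q. g (subst_matrix \<theta> *v abel q + abel p)) b w)"
proof -
  let ?M = "subst_matrix \<theta> :: real ^ 'd ^ 'd"
  let ?A = "\<lambda>b. {(p, s). p @ [a] @ s \<in> set_pmf (\<theta> b)}"
  have fin: "finite (set_pmf (\<theta> b))" for b
    using assms(1) by (simp add: random_substitution_def)
  have finA: "finite (?A b)" for b
    using fin by (rule finite_decompositions)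
  have "measure_pmf.expectation (subst_word \<theta> w) (occ_sum (\<lambda>p. g (abel p)) a) =
     (\<Sum>b\<in>UNIV. occ_sum (\<lambda>q. \<Sum>(p, s)\<in>?A b. pmf (\<theta> b) (p @ [a] @ s) *
         g (?M *v abel q + abel p)) b w)"
    unfolding expectation_occ_sum_subst_word[OF assms] expectation_occ_sum_eq_sum_decompositions[OF fin]
    by (rule sum_positions_eq_sum_occ_sum)
  also have "\<dots> = (\<Sum>b\<in>UNIV. \<Sum>(p, s)\<in>?A b. pmf (\<theta> b) (p @ [a] @ s) *
      occ_sum (\<lambda>q. g (?M *v abel q + abel p)) b w)"
    unfolding occ_sum_eq_sum_positions
    by (intro sum.cong refl, subst sum.swap) (simp add: case_prod_unfold sum_distrib_left)
  also have "\<dots> = (\<Sum>(p, b, s)\<in>{(p, b, s). (p, s) \<in> ?A b}. pmf (\<theta> b) (p @ [a] @ s) *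
      occ_sum (\<lambda>q. g (?M *v abel q + abel p)) b w)"
    by (rule sum_triples_eq_sum_letters[OF finA, symmetric])
  finally show ?thesis by simp
qed

text \<open>
  The finite-time form of the self-similarity relation, for an arbitrary test function \<open>f\<close>.
\<close>
lemma expectation_occ_sum_subst_iter_Suc:
  fixes \<theta> :: "'d::finite \<Rightarrow> 'd list pmf"
  assumes "random_substitution \<theta>" "compatible \<theta>"
    and "L v* subst_matrix \<theta> = l *\<^sub>R L" "subst_matrix \<theta> *v R = l *\<^sub>R R"
  shows "measure_pmf.expectation (subst_iter \<theta> (Suc n) v) (occ_sum (\<lambda>p. f (proj L R (abel p))) a) =
    (\<Sum>(p, b, s)\<in>{(p, b, s). p @ [a] @ s \<in> set_pmf (\<theta> b)}. pmf (\<theta> b) (p @ [a] @ s) *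
      measure_pmf.expectation (subst_iter \<theta> n v)
        (occ_sum (\<lambda>q. f (prefix_map \<theta> L R p (proj L R (abel q)))) b))"
proof -
  have "measure_pmf.expectation (subst_iter \<theta> (Suc n) v) (occ_sum (\<lambda>p. f (proj L R (abel p))) a) =
    measure_pmf.expectation (subst_iter \<theta> n v) (\<lambda>w.
    (\<Sum>(p, b, s)\<in>{(p, b, s). p @ [a] @ s \<in> set_pmf (\<theta> b)}. pmf (\<theta> b) (p @ [a] @ s) *
      occ_sum (\<lambda>q. f (prefix_map \<theta> L R p (proj L R (abel q)))) b w))"
    using assms by (simp add: expectation_bind_pmf_finite finite_set_pmf_subst_iter
      finite_set_pmf_subst_word prefix_map_def proj_matrix_vector[OF assms(3,4)]
      expectation_occ_sum_subst_word_eq_sum_triples[OF assms(1,2), of _ "\<lambda>x. f (proj L R x)", simplified])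
  also have "\<dots> = (\<Sum>(p, b, s)\<in>{(p, b, s). p @ [a] @ s \<in> set_pmf (\<theta> b)}. pmf (\<theta> b) (p @ [a] @ s) *
      measure_pmf.expectation (subst_iter \<theta> n v)
        (occ_sum (\<lambda>q. f (prefix_map \<theta> L R p (proj L R (abel q)))) b))"
    by (simp add: case_prod_unfold integrable_measure_pmf_finite finite_set_pmf_subst_iter assms)
  finally show ?thesis .
qed

section \<open>Finite Borel measures and bounded continuous functions\<close>

text \<open>
  The indicator of a closed set is the pointwise limit of bounded continuous functions that decay
  ever faster with the distance from the set.
\<close>
lemma integral_infdist_approx_closed:
  fixes M :: "'a::metric_space measure"
  assumes "finite_measure M" and sets: "sets M = sets borel" and C: "closed C" "C \<noteq> {}"
  shows "(\<lambda>k. \<integral>x. max 0 (1 - real k * infdist x C) \<partial>M) \<longlonglongrightarrow> measure M C"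
proof -
  interpret finite_measure M by fact
  have C_sets: "C \<in> sets M" using C sets by simp
  have meas: "f \<in> borel_measurable M" if "continuous_on UNIV f" for f :: "'a \<Rightarrow> real"
    using borel_measurable_continuous_onI[OF that] sets by (simp cong: measurable_cong_sets)
  have lim: "(\<lambda>k. max 0 (1 - real k * infdist x C)) \<longlonglongrightarrow> indicat_real C x" for x
  proof (cases "x \<in> C")
    case True
    then show ?thesis using C by (simp add: infdist_zero)
  next
    case False
    then have pos: "0 < infdist x C" using C by (simp add: infdist_pos_not_in_closed)
    obtain k0 where k0: "1 < real k0 * infdist x C"
      using reals_Archimedean3[OF pos] by blast
    have "max 0 (1 - real k * infdist x C) = indicat_real C x" if "k0 \<le> k" for k
    proof -
      have "real k0 * infdist x C \<le> real k * infdist x C"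
        using that pos by (intro mult_right_mono) auto
      then show ?thesis using k0 False by simp
    qed
    then show ?thesis
      by (intro tendsto_eventually eventually_sequentiallyI[of k0]) auto
  qed
  have "(\<lambda>k. \<integral>x. max 0 (1 - real k * infdist x C) \<partial>M) \<longlonglongrightarrow> (\<integral>x. indicat_real C x \<partial>M)"
    by (rule integral_dominated_convergence[where w = "\<lambda>_. 1"])
       (use lim C_sets in \<open>auto intro!: meas continuous_intros simp: infdist_nonneg\<close>)
  then show ?thesis using C_sets by simp
qed

text \<open>
  Bounded continuous functions determine finite Borel measures: the identity holds on closed sets
  by approximation of their indicators, and the sets on which it holds form a Dynkin system. It is
  stated for a linear combination of measures, so that no combined measure has to be constructed
  from the summands.
\<close>
lemma measure_eq_sum_if_integral_continuous_eq_sum: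
  fixes M :: "'a::metric_space measure" and N :: "'i \<Rightarrow> 'a measure" and c :: "'i \<Rightarrow> real"
  assumes M: "finite_measure M" "sets M = sets borel"
    and N: "\<And>i. i \<in> I \<Longrightarrow> finite_measure (N i)" "\<And>i. i \<in> I \<Longrightarrow> sets (N i) = sets borel"
    and eq: "\<And>f :: 'a \<Rightarrow> real. continuous_on UNIV f \<Longrightarrow> bounded (range f) \<Longrightarrow>
      (\<integral>x. f x \<partial>M) = (\<Sum>i\<in>I. c i * (\<integral>x. f x \<partial>N i))"
    and B: "B \<in> sets borel"
  shows "measure M B = (\<Sum>i\<in>I. c i * measure (N i) B)"
proof -
  have space: "space M = UNIV" "i \<in> I \<Longrightarrow> space (N i) = UNIV" for i
    using sets_eq_imp_space_eq[OF M(2)] sets_eq_imp_space_eq[OF N(2)] by auto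
  have sets_iff: "A \<in> sets M \<longleftrightarrow> A \<in> sigma_sets UNIV (Collect closed)"
    "i \<in> I \<Longrightarrow> A \<in> sets (N i) \<longleftrightarrow> A \<in> sigma_sets UNIV (Collect closed)" for A i
    using M(2) N(2) by (simp_all add: borel_eq_closed)
  have "Int_stable (Collect closed :: 'a set set)" by (auto simp: Int_stable_def)
  moreover have "(Collect closed :: 'a set set) \<subseteq> Pow UNIV" by simp
  moreover have "B \<in> sigma_sets UNIV (Collect closed)" using B by (simp add: borel_eq_closed)
  ultimately show ?thesis
  proof (induction B rule: sigma_sets_induct_disjoint)
    case (basic C)
    then have C: "closed C" by simp
    show ?case
    proof (cases "C = {}")
      case False
      have "bounded (range (\<lambda>x. max 0 (1 - real k * infdist x C)))" for k
        by (rule boundedI[of _ 1]) (auto simp: infdist_nonneg)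
      then have int: "(\<integral>x. max 0 (1 - real k * infdist x C) \<partial>M) =
          (\<Sum>i\<in>I. c i * (\<integral>x. max 0 (1 - real k * infdist x C) \<partial>N i))" for k
        by (intro eq continuous_intros)
      have "(\<lambda>k. \<Sum>i\<in>I. c i * (\<integral>x. max 0 (1 - real k * infdist x C) \<partial>N i))
          \<longlonglongrightarrow> (\<Sum>i\<in>I. c i * measure (N i) C)"
        using C False N by (intro tendsto_intros integral_infdist_approx_closed) auto
      with integral_infdist_approx_closed[OF M C False] show ?thesis
        unfolding int by (rule LIMSEQ_unique)
    qed simp
  next
    case empty
    then show ?case by simp
  next
    case (compl A)
    have "continuous_on UNIV (\<lambda>_. 1 :: real)" "bounded (range (\<lambda>_. 1 :: real))" by auto
    from eq[OF this] have total: "measure M UNIV = (\<Sum>i\<in>I. c i * measure (N i) UNIV)"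
      by (simp add: space)
    have "measure M (UNIV - A) = measure M UNIV - measure M A"
      using finite_measure.finite_measure_compl[OF M(1), of A] compl by (simp add: space sets_iff)
    moreover have "measure (N i) (UNIV - A) = measure (N i) UNIV - measure (N i) A" if "i \<in> I" for i
      using finite_measure.finite_measure_compl[OF N(1)[OF that], of A] compl that
      by (simp add: space sets_iff)
    ultimately show ?case
      using compl by (simp add: total right_diff_distrib sum_subtractf)
  next
    case (union A)
    have "(\<lambda>k. measure M (A k)) sums measure M (\<Union>k. A k)"
      using union by (intro finite_measure.finite_measure_UNION[OF M(1)]) (auto simp: sets_iff)
    moreover have "(\<lambda>k. measure (N i) (A k)) sums measure (N i) (\<Union>k. A k)" if "i \<in> I" for i
      using union that by (intro finite_measure.finite_measure_UNION[OF N(1)]) (auto simp: sets_iff)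
    then have "(\<lambda>k. \<Sum>i\<in>I. c i * measure (N i) (A k)) sums (\<Sum>i\<in>I. c i * measure (N i) (\<Union>k. A k))"
      by (intro sums_sum sums_mult)
    ultimately show ?case using union sums_unique2 by simp
  qed
qed

section \<open>Integrals against the expected measures\<close>

lemma emeasure_word_measure:
  assumes "L \<bullet> R = 1" and B: "B \<in> sets (borel_hyperplane L)"
  shows "emeasure (word_measure L R a w) B =
    of_nat (card {m. m < length w \<and> w ! m = a \<and> proj L R (abel (take m w)) \<in> B})"
proof -
  have "emeasure (word_measure L R a w) B = emeasure (count_space {m. m < length w \<and> w ! m = a})
      ((\<lambda>m. proj L R (abel (take m w))) -` B \<inter> {m. m < length w \<and> w ! m = a})"
    unfolding word_measure_def
    by (subst emeasure_distr)
       (use assms in \<open>auto simp: space_restrict_space proj_in_hyperplane\<close>)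
  also have "(\<lambda>m. proj L R (abel (take m w))) -` B \<inter> {m. m < length w \<and> w ! m = a} =
      {m. m < length w \<and> w ! m = a \<and> proj L R (abel (take m w)) \<in> B}"
    by auto
  finally show ?thesis by (subst (asm) emeasure_count_space_finite) auto
qed

text \<open>
  The set function defining the expected measure is that of an image of a weighted counting measure
  on the finitely many pairs of a realisation and a position of \<open>a\<close> in it. This shows that it is
  indeed a measure and makes its integrals finite sums.
\<close>
lemma expected_measure_eq_distr_point_measure:
  fixes \<theta> :: "'d::finite \<Rightarrow> 'd list pmf" and n :: nat and v :: "'d list"
  assumes "random_substitution \<theta>" "L \<bullet> R = 1"
  defines "P \<equiv> subst_iter \<theta> n v"
  shows "expected_measure \<theta> L R a n v =
    distr (point_measure (SIGMA w:set_pmf P. {m. m < length w \<and> w ! m = a}) (\<lambda>(w, m). ennreal (pmf P w)))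
      (borel_hyperplane L) (\<lambda>(w, m). proj L R (abel (take m w)))"
    (is "_ = distr (point_measure ?S ?f) _ ?g")
proof -
  have finP: "finite (set_pmf P)"
    using assms(1) by (simp add: P_def finite_set_pmf_subst_iter)
  then have finS: "finite ?S" by auto
  let ?D = "distr (point_measure ?S ?f) (borel_hyperplane L) ?g"
  have g: "?g \<in> measurable (point_measure ?S ?f) (borel_hyperplane L)"
    using assms(2) by (auto simp: measurable_def space_point_measure sets_point_measure
        space_restrict_space proj_in_hyperplane)
  have sets: "sigma_sets (hyperplane L) (sets (borel_hyperplane L)) = sets (borel_hyperplane L)"
    using sets.sigma_sets_eq[of "borel_hyperplane L"] by (simp add: space_restrict_space)
  have pow: "sets (borel_hyperplane L) \<subseteq> Pow (hyperplane L)"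
    using sets.space_closed[of "borel_hyperplane L"] by (simp add: space_restrict_space)
  have "(\<integral>\<^sup>+ w. emeasure (word_measure L R a w) B \<partial>measure_pmf P) = emeasure ?D B"
    if B: "B \<in> sets (borel_hyperplane L)" for B
  proof -
    let ?A = "\<lambda>w. {m. m < length w \<and> w ! m = a \<and> proj L R (abel (take m w)) \<in> B}"
    have "emeasure ?D B = (\<Sum>(w, m)\<in>Sigma (set_pmf P) ?A. ennreal (pmf P w))"
      using finS by (subst emeasure_distr[OF g B], subst emeasure_point_measure_finite)
        (auto simp: space_point_measure intro!: sum.cong)
    also have "\<dots> = (\<Sum>w\<in>set_pmf P. \<Sum>m\<in>?A w. ennreal (pmf P w))"
      using finP by (subst sum.Sigma) auto
    also have "\<dots> = (\<integral>\<^sup>+ w. emeasure (word_measure L R a w) B \<partial>measure_pmf P)"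
      using finP by (subst nn_integral_measure_pmf_finite) (auto simp: emeasure_word_measure assms(2) B)
    finally show ?thesis ..
  qed
  then have "expected_measure \<theta> L R a n v = measure_of (hyperplane L) (sets (borel_hyperplane L)) (emeasure ?D)"
    unfolding expected_measure_def P_def[symmetric] by (intro measure_of_eq pow) (simp add: sets)
  also have "\<dots> = ?D"
    using measure_of_of_measure[of ?D] by (simp add: space_restrict_space)
  finally show ?thesis .
qed

lemma integral_scale_measure:
  fixes f :: "'a \<Rightarrow> real"
  assumes "0 \<le> c" "f \<in> borel_measurable M"
  shows "(\<integral>x. f x \<partial>scale_measure (ennreal c) M) = c * (\<integral>x. f x \<partial>M)"
proof -
  have "scale_measure (ennreal c) M = density M (\<lambda>_. ennreal c)"
    by (intro measure_eqI) (auto simp: emeasure_density_const)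
  then show ?thesis using assms by (simp add: integral_density)
qed

lemma integral_scaled_expected_measure:
  fixes f :: "real ^ 'd::finite \<Rightarrow> real"
  assumes "random_substitution \<theta>" "L \<bullet> R = 1" "continuous_on (hyperplane L) f" "0 \<le> c"
  shows "(\<integral>x. f x \<partial>scale_measure (ennreal c) (expected_measure \<theta> L R a n v)) =
    c * measure_pmf.expectation (subst_iter \<theta> n v) (occ_sum (\<lambda>p. f (proj L R (abel p))) a)"
proof -
  let ?P = "subst_iter \<theta> n v"
  let ?S = "SIGMA w:set_pmf ?P. {m. m < length w \<and> w ! m = a}"
  have finP: "finite (set_pmf ?P)" using assms(1) by (rule finite_set_pmf_subst_iter)
  have f: "f \<in> borel_measurable (borel_hyperplane L)"
    using assms(3) by (rule borel_measurable_continuous_on_restrict)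
  have g: "(\<lambda>(w, m). proj L R (abel (take m w))) \<in>
      measurable (point_measure ?S (\<lambda>(w, m). ennreal (pmf ?P w))) (borel_hyperplane L)"
    using assms(2) by (auto simp: measurable_def space_point_measure sets_point_measure
        space_restrict_space proj_in_hyperplane)
  have "(\<integral>x. f x \<partial>expected_measure \<theta> L R a n v) =
      (\<integral>(w, m). f (proj L R (abel (take m w))) \<partial>point_measure ?S (\<lambda>(w, m). ennreal (pmf ?P w)))"
    unfolding expected_measure_eq_distr_point_measure[OF assms(1,2)] integral_distr[OF g f]
    by (simp add: case_prod_unfold)
  also have "\<dots> = (\<Sum>(w, m)\<in>?S. pmf ?P w * f (proj L R (abel (take m w))))"
    using finP lebesgue_integral_point_measure_finite[of ?S "\<lambda>(w, m). pmf ?P w"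
        "\<lambda>(w, m). f (proj L R (abel (take m w)))"]
    by (simp add: case_prod_unfold)
  also have "\<dots> = (\<Sum>w\<in>set_pmf ?P. pmf ?P w * occ_sum (\<lambda>p. f (proj L R (abel p))) a w)"
    using finP by (subst sum.Sigma[symmetric]) (auto simp: occ_sum_eq_sum_positions sum_distrib_left)
  also have "\<dots> = measure_pmf.expectation ?P (occ_sum (\<lambda>p. f (proj L R (abel p))) a)"
    using finP by (subst integral_measure_pmf[of "set_pmf ?P"]) auto
  finally show ?thesis
    using assms(4) f by (subst integral_scale_measure)
      (auto simp: expected_measure_eq_distr_point_measure[OF assms(1,2)])
qed

lemma rauzy_measure_limit:
  fixes f :: "real ^ 'd::finite \<Rightarrow> real"
  assumes "random_substitution \<theta>" "L \<bullet> R = 1" "is_rauzy_measure \<theta> L R a \<mu>" "v \<noteq> []"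
    and "continuous_on (hyperplane L) f" "bounded (f ` hyperplane L)"
  shows "(\<lambda>n. measure_pmf.expectation (subst_iter \<theta> n v) (occ_sum (\<lambda>p. f (proj L R (abel p))) a)
      / real (iter_length \<theta> n v)) \<longlonglongrightarrow> (\<integral>x. f x \<partial>\<mu>)"
proof -
  have "(\<lambda>n. \<integral>x. f x \<partial>scale_measure (ennreal (1 / real (iter_length \<theta> n v)))
      (expected_measure \<theta> L R a n v)) \<longlonglongrightarrow> (\<integral>x. f x \<partial>\<mu>)"
    using assms(3-6) unfolding is_rauzy_measure_def weak_limit_on_def by blast
  then show ?thesis by (simp add: integral_scaled_expected_measure[OF assms(1,2,5)])
qed

section \<open>Growth of the lengths\<close>

text \<open>
  Convergence of the direction of \<open>x\<close> suffices for its size to grow by the factor \<open>l\<close>: the functional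
  \<open>L\<close> grows by exactly that factor, and \<open>(L \<bullet> x n) / s n\<close> tends to a limit \<open>k\<close>, which is positive
  since \<open>r\<close> is a probability vector and \<open>L\<close> has positive entries.
\<close>
lemma ratio_tendsto_eigenvalue:
  fixes x :: "nat \<Rightarrow> real ^ 'd::finite" and L :: "real ^ 'd" and r :: "'d \<Rightarrow> real"
  defines "s \<equiv> \<lambda>n. \<Sum>i\<in>UNIV. x n $ i"
  assumes L: "\<And>i. 0 < L $ i" and step: "\<And>n. L \<bullet> x (Suc n) = l * (L \<bullet> x n)"
    and nonneg: "\<And>n i. 0 \<le> x n $ i" and s: "\<And>n. s n \<noteq> 0"
    and lim: "\<And>i. (\<lambda>n. x n $ i / s n) \<longlonglongrightarrow> r i"
  shows "(\<lambda>n. s (Suc n) / s n) \<longlonglongrightarrow> l"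
proof -
  define k where "k = (\<Sum>i\<in>UNIV. L $ i * r i)"
  define y where "y n = (L \<bullet> x n) / s n" for n
  have s_pos: "0 < s n" for n
    using s[of n] nonneg by (simp add: s_def less_le sum_nonneg)
  have y: "y \<longlonglongrightarrow> k"
  proof -
    have "y = (\<lambda>n. \<Sum>i\<in>UNIV. L $ i * (x n $ i / s n))"
      by (simp add: fun_eq_iff y_def inner_vec_def sum_divide_distrib)
    then show ?thesis unfolding k_def by (simp only:) (intro tendsto_intros lim)
  qed
  have r: "0 \<le> r i" for i
    using lim[of i] by (rule LIMSEQ_le_const) (use nonneg s_pos in \<open>auto simp: less_imp_le\<close>)
  have "(\<lambda>n. \<Sum>i\<in>UNIV. x n $ i / s n) \<longlonglongrightarrow> (\<Sum>i\<in>UNIV. r i)"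
    by (intro tendsto_intros lim)
  moreover have "(\<Sum>i\<in>UNIV. x n $ i / s n) = 1" for n
    using s[of n] by (simp add: sum_divide_distrib[symmetric] s_def)
  ultimately have "(\<Sum>i\<in>UNIV. r i) = 1"
    by (simp add: LIMSEQ_const_iff)
  then obtain i where "r i \<noteq> 0"
    by (metis sum.neutral zero_neq_one)
  then have k: "0 < k"
    unfolding k_def using L r by (intro sum_pos2[of _ i]) (auto simp: less_le)
  have "\<forall>\<^sub>F n in sequentially. 0 < y (Suc n)"
    using order_tendstoD(1)[OF LIMSEQ_Suc[OF y] k] .
  then have ev: "\<forall>\<^sub>F n in sequentially. l * y n / y (Suc n) = s (Suc n) / s n"
    by eventually_elim (use s step in \<open>auto simp: y_def field_simps\<close>)
  have "(\<lambda>n. l * y n / y (Suc n)) \<longlonglongrightarrow> l * k / k"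
    using k by (intro tendsto_intros y LIMSEQ_Suc) auto
  then show ?thesis using k by (simp add: tendsto_cong[OF ev])
qed

lemma Nil_notin_set_pmf_subst_iter:
  assumes "random_substitution \<theta>" "v \<noteq> []"
  shows "[] \<notin> set_pmf (subst_iter \<theta> n v)"
proof (induction n)
  case (Suc n)
  have nonempty: "[] \<notin> set_pmf (subst_word \<theta> u)" if "u \<noteq> []" for u
    using that assms(1) by (cases u) (auto simp: random_substitution_def)
  show ?case
  proof
    assume "[] \<in> set_pmf (subst_iter \<theta> (Suc n) v)"
    then obtain u where "u \<in> set_pmf (subst_iter \<theta> n v)" "[] \<in> set_pmf (subst_word \<theta> u)"
      by auto
    with Suc nonempty show False by metis
  qed
qed (use assms in auto)

lemma expectation_count_list_subst_iter:
  assumes "compatible \<theta>" "w \<in> set_pmf (subst_iter \<theta> n v)"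
  shows "measure_pmf.expectation (subst_iter \<theta> n v) (\<lambda>u. real (count_list u a)) = abel w $ a"
proof -
  have "real (count_list u a) = abel w $ a" if "u \<in> set_pmf (subst_iter \<theta> n v)" for u
  proof -
    have "abel u = abel w"
      unfolding abel_subst_iter[OF assms(1) that] abel_subst_iter[OF assms] ..
    then have "abel u $ a = abel w $ a" by simp
    then show ?thesis by (simp add: abel_def)
  qed
  then have "measure_pmf.expectation (subst_iter \<theta> n v) (\<lambda>u. real (count_list u a)) =
      measure_pmf.expectation (subst_iter \<theta> n v) (\<lambda>_. abel w $ a)"
    by (intro integral_cong_AE) (simp_all add: AE_measure_pmf_iff)
  then show ?thesis by simp
qed

text \<open>
  The letter frequencies converge because they are the total masses of the scaled expected measures,
  that is, their integrals of the constant function \<open>1\<close>.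
\<close>
lemma iter_length_ratio_tendsto:
  fixes \<theta> :: "'d::finite \<Rightarrow> 'd list pmf"
  assumes \<theta>: "random_substitution \<theta>" "compatible \<theta>"
    and L: "is_left_pf_eigenvector (subst_matrix \<theta>) l L" and "L \<bullet> R = 1"
    and \<mu>: "\<And>a. is_rauzy_measure \<theta> L R a (\<mu> a)" and v: "v \<noteq> []"
  shows "(\<lambda>n. real (iter_length \<theta> (Suc n) v) / real (iter_length \<theta> n v)) \<longlonglongrightarrow> l"
proof -
  define w where "w n = (SOME w. w \<in> set_pmf (subst_iter \<theta> n v))" for n
  have w: "w n \<in> set_pmf (subst_iter \<theta> n v)" for n
    unfolding w_def by (simp add: some_in_eq set_pmf_not_empty)
  have len: "(\<Sum>i\<in>UNIV. abel (w n) $ i) = real (iter_length \<theta> n v)" for n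
    by (simp only: sum_abel iter_length_def w_def)
  have "(\<lambda>n. (\<Sum>i\<in>UNIV. abel (w (Suc n)) $ i) / (\<Sum>i\<in>UNIV. abel (w n) $ i)) \<longlonglongrightarrow> l"
  proof (rule ratio_tendsto_eigenvalue)
    show "0 < L $ i" for i using L by (simp add: is_left_pf_eigenvector_def)
    show "L \<bullet> abel (w (Suc n)) = l * (L \<bullet> abel (w n))" for n
      unfolding abel_subst_iter[OF \<theta>(2) w] funpow.simps o_apply
      using L by (intro inner_left_eigenvector) (simp add: is_left_pf_eigenvector_def)
    show "0 \<le> abel (w n) $ i" for n i by (simp add: abel_def)
    show "(\<Sum>i\<in>UNIV. abel (w n) $ i) \<noteq> 0" for n
    proof -
      have "w n \<noteq> []" using w[of n] Nil_notin_set_pmf_subst_iter[OF \<theta>(1) v, of n] by auto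
      then show ?thesis by (simp add: sum_abel)
    qed
    show "(\<lambda>n. abel (w n) $ i / (\<Sum>i\<in>UNIV. abel (w n) $ i)) \<longlonglongrightarrow> (\<integral>x. 1 \<partial>\<mu> i)" for i
    proof -
      have one: "continuous_on (hyperplane L) (\<lambda>_. 1 :: real)"
        "bounded ((\<lambda>_. 1 :: real) ` hyperplane L)"
        by (auto intro: bounded_subset[of "{1}"])
      have "measure_pmf.expectation (subst_iter \<theta> n v) (occ_sum (\<lambda>_. 1) i) = abel (w n) $ i" for n
        unfolding occ_sum_one using \<theta>(2) w by (rule expectation_count_list_subst_iter)
      with rauzy_measure_limit[OF \<theta>(1) \<open>L \<bullet> R = 1\<close> \<mu>[of i] v one] show ?thesis
        by (simp add: len)
    qed
  qed
  then show ?thesis by (simp only: len)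
qed

section \<open>Self-similarity of the Rauzy measures\<close>

lemma prefix_map_in_hyperplane:
  assumes "is_left_pf_eigenvector (subst_matrix \<theta>) l L" "L \<bullet> R = 1" "x \<in> hyperplane L"
  shows "prefix_map \<theta> L R p x \<in> hyperplane L"
proof -
  have "L \<bullet> (subst_matrix \<theta> *v x) = l * (L \<bullet> x)"
    using assms(1) by (intro inner_left_eigenvector) (simp add: is_left_pf_eigenvector_def)
  with assms(3) proj_in_hyperplane[OF assms(2), of "abel p"] show ?thesis
    by (simp add: prefix_map_def hyperplane_def inner_add_right)
qed

lemma continuous_on_prefix_map: "continuous_on S (prefix_map \<theta> L R p)"
  unfolding prefix_map_def
  by (intro continuous_intros linear_continuous_on matrix_vector_mul_bounded_linear)

text \<open>
  Both sides are limits of the finite-time relation divided by the length at time \<open>n\<close>. The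
  left-hand side of that relation lives at time \<open>n + 1\<close>, which is where the factor \<open>l\<close> comes from.
\<close>
lemma integral_rauzy_measure_eq_sum:
  fixes \<theta> :: "'d::finite \<Rightarrow> 'd list pmf" and f :: "real ^ 'd \<Rightarrow> real"
  assumes \<theta>: "random_substitution \<theta>" "compatible \<theta>"
    and L: "is_left_pf_eigenvector (subst_matrix \<theta>) l L"
    and R: "is_right_pf_eigenvector (subst_matrix \<theta>) l R" and LR: "L \<bullet> R = 1"
    and \<mu>: "\<And>a. is_rauzy_measure \<theta> L R a (\<mu> a)"
    and f: "continuous_on (hyperplane L) f" "bounded (f ` hyperplane L)"
  shows "l * (\<integral>x. f x \<partial>\<mu> a) =
    (\<Sum>(p, b, s)\<in>{(p, b, s). p @ [a] @ s \<in> set_pmf (\<theta> b)}. pmf (\<theta> b) (p @ [a] @ s) *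
      (\<integral>x. f (prefix_map \<theta> L R p x) \<partial>\<mu> b))"
proof -
  \<comment> \<open>The limit is the same for all starting words; any non-empty one will do.\<close>
  define v :: "'d list" where "v = [undefined]"
  then have v: "v \<noteq> []" by simp
  define len where "len n = real (iter_length \<theta> n v)" for n
  define J where "J g b n =
    measure_pmf.expectation (subst_iter \<theta> n v) (occ_sum (\<lambda>q. g (proj L R (abel q))) b)" for g b n
  let ?I = "{(p, b, s). p @ [a] @ s \<in> set_pmf (\<theta> b)}"
  have lim: "(\<lambda>n. J g b n / len n) \<longlonglongrightarrow> (\<integral>x. g x \<partial>\<mu> b)"
    if "continuous_on (hyperplane L) g" "bounded (g ` hyperplane L)" for g b
    unfolding J_def len_def using rauzy_measure_limit[OF \<theta>(1) LR \<mu> v that] .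
  have "L v* subst_matrix \<theta> = l *\<^sub>R L" "subst_matrix \<theta> *v R = l *\<^sub>R R"
    using L R by (simp_all add: is_left_pf_eigenvector_def is_right_pf_eigenvector_def)
  then have step: "J f a (Suc n) = (\<Sum>(p, b, s)\<in>?I. pmf (\<theta> b) (p @ [a] @ s) *
      J (\<lambda>x. f (prefix_map \<theta> L R p x)) b n)" for n
    unfolding J_def by (rule expectation_occ_sum_subst_iter_Suc[OF \<theta>])
  have len_pos: "len n \<noteq> 0" for n
  proof -
    have "(SOME w. w \<in> set_pmf (subst_iter \<theta> n v)) \<in> set_pmf (subst_iter \<theta> n v)"
      by (simp add: some_in_eq set_pmf_not_empty)
    then show ?thesis
      using Nil_notin_set_pmf_subst_iter[OF \<theta>(1) v, of n] by (auto simp: len_def iter_length_def)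
  qed
  have "(\<lambda>n. (J f a (Suc n) / len (Suc n)) * (len (Suc n) / len n)) \<longlonglongrightarrow> (\<integral>x. f x \<partial>\<mu> a) * l"
    using iter_length_ratio_tendsto[OF \<theta> L LR \<mu> v]
    by (intro tendsto_mult LIMSEQ_Suc[OF lim[OF f]]) (simp add: len_def)
  then have 1: "(\<lambda>n. J f a (Suc n) / len n) \<longlonglongrightarrow> (\<integral>x. f x \<partial>\<mu> a) * l"
    by (simp add: len_pos)
  have maps: "prefix_map \<theta> L R p ` hyperplane L \<subseteq> hyperplane L" for p
    using prefix_map_in_hyperplane[OF L LR] by blast
  have lim_p: "(\<lambda>n. J (\<lambda>x. f (prefix_map \<theta> L R p x)) b n / len n) \<longlonglongrightarrow>
      (\<integral>x. f (prefix_map \<theta> L R p x) \<partial>\<mu> b)" for p b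
  proof (rule lim)
    show "continuous_on (hyperplane L) (\<lambda>x. f (prefix_map \<theta> L R p x))"
      using f(1) continuous_on_prefix_map maps by (rule continuous_on_compose2)
    show "bounded ((\<lambda>x. f (prefix_map \<theta> L R p x)) ` hyperplane L)"
      using f(2) by (rule bounded_subset) (use maps in auto)
  qed
  have "(\<lambda>n. \<Sum>(p, b, s)\<in>?I. pmf (\<theta> b) (p @ [a] @ s) *
      (J (\<lambda>x. f (prefix_map \<theta> L R p x)) b n / len n)) \<longlonglongrightarrow>
    (\<Sum>(p, b, s)\<in>?I. pmf (\<theta> b) (p @ [a] @ s) * (\<integral>x. f (prefix_map \<theta> L R p x) \<partial>\<mu> b))"
    unfolding case_prod_unfold by (intro tendsto_intros lim_p)
  then have 2: "(\<lambda>n. J f a (Suc n) / len n) \<longlonglongrightarrow>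
    (\<Sum>(p, b, s)\<in>?I. pmf (\<theta> b) (p @ [a] @ s) * (\<integral>x. f (prefix_map \<theta> L R p x) \<partial>\<mu> b))"
    by (simp add: step sum_divide_distrib case_prod_unfold)
  from LIMSEQ_unique[OF 1 2] show ?thesis by (simp add: mult.commute)
qed

theorem proposition5p7:
  fixes \<theta> :: "'d::finite \<Rightarrow> 'd list pmf"
    and lam :: real
    and L R :: "real ^ 'd"
    and \<mu> :: "'d \<Rightarrow> (real ^ 'd) measure"
  assumes "random_substitution \<theta>"
    and "irreducible_pisot \<theta> lam"
    and "is_left_pf_eigenvector (subst_matrix \<theta>) lam L"
    and "is_right_pf_eigenvector (subst_matrix \<theta>) lam R"
    and "(\<Sum>i\<in>UNIV. \<bar>R $ i\<bar>) = 1"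
    and "L \<bullet> R = 1"
    and "\<And>a. is_rauzy_measure \<theta> L R a (\<mu> a)"
  shows "\<forall>a. \<forall>B \<in> sets (borel_hyperplane L).
    measure (\<mu> a) B =
      1 / lam * (\<Sum>(p, b, s) \<in> {(p, b, s). p @ [a] @ s \<in> set_pmf (\<theta> b)}.
        pmf (\<theta> b) (p @ [a] @ s) *
        measure (\<mu> b) (prefix_map \<theta> L R p -` B \<inter> hyperplane L))"
proof (intro allI ballI)
  fix a B
  assume B: "B \<in> sets (borel_hyperplane L)"
  let ?I = "{(p, b, s). p @ [a] @ s \<in> set_pmf (\<theta> b)}"
  let ?f = "prefix_map \<theta> L R"
  have comp: "compatible \<theta>" and lam: "1 < lam"
    using assms(2) by (auto simp: irreducible_pisot_def primitive_substitution_def)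
  have sets: "sets (\<mu> b) = sets (borel_hyperplane L)" and fin: "finite_measure (\<mu> b)" for b
    using assms(7)[of b] by (auto simp: is_rauzy_measure_def)
  have space: "space (\<mu> b) = hyperplane L" for b
    using sets_eq_imp_space_eq[OF sets] by (simp add: space_restrict_space)
  have "closed (hyperplane L)" unfolding hyperplane_def by (rule closed_hyperplane)
  with B have B_borel: "B \<in> sets borel" and B_sub: "B \<subseteq> hyperplane L"
    by (auto simp: sets_restrict_space_iff)
  have meas: "g \<in> borel_measurable (\<mu> b)" if "continuous_on (hyperplane L) g"
    for b and g :: "real ^ 'd \<Rightarrow> real ^ 'd"
    using borel_measurable_continuous_on_restrict[OF that] sets by (simp cong: measurable_cong_sets)
  have f_meas: "?f p \<in> borel_measurable (\<mu> b)" for p b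
    by (intro meas continuous_on_prefix_map)
  have id_meas: "(\<lambda>x. x) \<in> borel_measurable (\<mu> b)" for b
    by (intro meas continuous_intros)
  \<comment> \<open>Pushing the measures forward to the whole space turns them into Borel measures on a metric space.\<close>
  have "measure (distr (\<mu> a) borel (\<lambda>x. x)) B =
      (\<Sum>i\<in>?I. (case i of (p, b, s) \<Rightarrow> pmf (\<theta> b) (p @ [a] @ s) / lam) *
        measure (case i of (p, b, s) \<Rightarrow> distr (\<mu> b) borel (?f p)) B)"
  proof (rule measure_eq_sum_if_integral_continuous_eq_sum)
    fix g :: "real ^ 'd \<Rightarrow> real"
    assume g: "continuous_on UNIV g" "bounded (range g)"
    then have g_meas: "g \<in> borel_measurable borel"
      by (intro borel_measurable_continuous_onI)
    have "lam * (\<integral>x. g x \<partial>\<mu> a) =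
        (\<Sum>(p, b, s)\<in>?I. pmf (\<theta> b) (p @ [a] @ s) * (\<integral>x. g (?f p x) \<partial>\<mu> b))"
      by (rule integral_rauzy_measure_eq_sum[OF assms(1) comp assms(3,4,6,7)])
        (use g in \<open>auto intro: continuous_on_subset bounded_subset\<close>)
    then have "(\<integral>x. g x \<partial>\<mu> a) =
        (\<Sum>(p, b, s)\<in>?I. pmf (\<theta> b) (p @ [a] @ s) * (\<integral>x. g (?f p x) \<partial>\<mu> b)) / lam"
      using lam by (simp add: field_simps)
    then show "(\<integral>x. g x \<partial>distr (\<mu> a) borel (\<lambda>x. x)) =
        (\<Sum>i\<in>?I. (case i of (p, b, s) \<Rightarrow> pmf (\<theta> b) (p @ [a] @ s) / lam) *
          (\<integral>x. g x \<partial>(case i of (p, b, s) \<Rightarrow> distr (\<mu> b) borel (?f p))))"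
      by (simp add: integral_distr[OF id_meas g_meas] integral_distr[OF f_meas g_meas]
          sum_divide_distrib case_prod_unfold)
  qed (use B_borel fin id_meas f_meas in
      \<open>auto simp: case_prod_unfold intro!: finite_measure.finite_measure_distr\<close>)
  moreover have "measure (distr (\<mu> a) borel (\<lambda>x. x)) B = measure (\<mu> a) B"
    using B_sub by (simp add: measure_distr[OF id_meas B_borel] space Int_absorb2)
  moreover have "measure (distr (\<mu> b) borel (?f p)) B = measure (\<mu> b) (?f p -` B \<inter> hyperplane L)"
    for p b
    by (simp add: measure_distr[OF f_meas B_borel] space)
  ultimately show "measure (\<mu> a) B =
      1 / lam * (\<Sum>(p, b, s)\<in>?I. pmf (\<theta> b) (p @ [a] @ s) *
        measure (\<mu> b) (?f p -` B \<inter> hyperplane L))"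
    by (simp add: sum_divide_distrib case_prod_unfold)
qed

end
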